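(* Let $\mathcal{G}$ be a groupoid and $\mathcal{H}$ a wide subgroupoid of $\mathcal{G}$. Let $\mathcal{N}_{\mathcal{G}}(\mathcal{H})=\{g\in\mathcal{G}\mid g^{-1}\mathcal{H}_{r(g)}g=\mathcal{H}_{d(g)}\}$ be the normalizer of $\mathcal{H}$ in $\mathcal{G}$. Then: 1. $\mathcal{N}_{\mathcal{G}}(\mathcal{H})$ is a wide subgroupoid of $\mathcal{G}$ that contains $\mathcal{H}$. 2. $\mathcal{H}$ is a normal subgroupoid of $\mathcal{N}_{\mathcal{G}}(\mathcal{H})$. 3. $\mathcal{N}_{\mathcal{G}}(\mathcal{H})$ is the greatest (with respect to inclusion) wide subgroupoid of $\mathcal{G}$ in which $\mathcal{H}$ is normal. 4. $\mathcal{N}_{\mathcal{G}}(\mathcal{H})=\mathcal{G}$ if and only if $\mathcal{H}$ is a normal subgroupoid of $\mathcal{G}$.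
   Context: Groupoids are taken in the algebraic sense. Let $\mathcal{G}$ be a set with a partial binary operation written as concatenation; $\exists gh$ means that the product $gh$ is defined. An element $e\in\mathcal{G}$ is an identity if $\exists eg$ implies $eg=g$ and $\exists g'e$ implies $g'e=g'$; $\mathcal{G}_0$ is the set of identities. $\mathcal{G}$ is a groupoid if: (1) $\exists g(hl)$ iff $\exists (gh)l$, and then $g(hl)=(gh)l$; (2) $\exists g(hl)$ iff $\exists gh$ and $\exists hl$; (3) for each $g$ there are unique $d(g),r(g)\in\mathcal{G}$ with $\exists g\,d(g)$, $\exists r(g)\,g$ and $g\,d(g)=g=r(g)\,g$; (4) for each $g$ there is $g^{-1}\in\mathcal{G}$ with $d(g)=g^{-1}g$ and $r(g)=gg^{-1}$. (Equivalently, $\mathcal{G}$ is the set of morphisms of a small category in which every morphism is invertible; $\exists gh$ iff $d(g)=r(h)$, and $\mathcal{G}_0=\{d(g)\mid g\in\mathcal{G}\}$.) For $e\in\mathcal{G}_0$, $\mathcal{G}_e=\{g\in\mathcal{G}\mid d(g)=r(g)=e\}$ is the isotropy group at $e$. A nonempty subset $\mathcal{H}\subseteq\mathcal{G}$ is a subgroupoid of $\mathcal{G}$ if for all $g,h\in\mathcal{H}$: $g^{-1}\in\mathcal{H}$, and $\exists gh$ implies $gh\in\mathcal{H}$. It is wide if $\mathcal{H}_0=\mathcal{G}_0$, equivalently $\mathcal{G}_0\subseteq\mathcal{H}$. A subgroupoid is itself a groupoid under the restricted operation. For a wide subgroupoid $\mathcal{H}$ and $e\in\mathcal{G}_0$,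 $\mathcal{H}_e=\mathcal{H}\cap\mathcal{G}_e$, and for $g\in\mathcal{G}$, $g^{-1}\mathcal{H}_{r(g)}g=\{g^{-1}hg\mid h\in\mathcal{H}_{r(g)}\}$. For a wide subgroupoid $\mathcal{H}$ and $g\in\mathcal{G}$, $g^{-1}\mathcal{H}g=\{g^{-1}hg\mid h\in\mathcal{H},\ r(h)=d(h)=r(g)\}$. A subgroupoid $\mathcal{H}$ of $\mathcal{G}$ is normal if it is wide and $g^{-1}\mathcal{H}g\subseteq\mathcal{H}$ for all $g\in\mathcal{G}$. *)

theory Defs
  imports "HOL-Algebra.Congruence"
begin

text \<open>
  The partial product is option-valued: \<open>g \<cdot>\<^bsub>G\<^esub> h = None\<close> means that the product is undefined.
  Only its values on \<open>carrier G\<close> matter, so \<open>G\<lparr>carrier := H\<rparr>\<close> is a closed subset \<open>H\<close> under the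
  restricted operation.
\<close>

record 'a partial_magma = "'a partial_object" +
  pmult :: "'a \<Rightarrow> 'a \<Rightarrow> 'a option" (infixl \<open>\<cdot>\<index>\<close> 70)

definition identities :: "('a, 'm) partial_magma_scheme \<Rightarrow> 'a set" where
  "identities G = {e \<in> carrier G. \<forall>g \<in> carrier G.
     (e \<cdot>\<^bsub>G\<^esub> g \<noteq> None \<longrightarrow> e \<cdot>\<^bsub>G\<^esub> g = Some g) \<and> (g \<cdot>\<^bsub>G\<^esub> e \<noteq> None \<longrightarrow> g \<cdot>\<^bsub>G\<^esub> e = Some g)}"

definition gdom :: "('a, 'm) partial_magma_scheme \<Rightarrow> 'a \<Rightarrow> 'a" where
  "gdom G g = (THE e. e \<in> carrier G \<and> g \<cdot>\<^bsub>G\<^esub> e = Some g)"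

definition gran :: "('a, 'm) partial_magma_scheme \<Rightarrow> 'a \<Rightarrow> 'a" where
  "gran G g = (THE e. e \<in> carrier G \<and> e \<cdot>\<^bsub>G\<^esub> g = Some g)"

text \<open>
  In \<open>mult_assoc\<close> and \<open>mult_defined_iff\<close>, \<open>Option.bind (h \<cdot> l) (\<lambda>x. g \<cdot> x)\<close> is \<open>g(hl)\<close>, which is
  defined iff both of its products are. Equality of the two sides of \<open>mult_assoc\<close> thus says that
  one is defined iff the other is, and that they then agree.
\<close>

locale groupoid =
  fixes G :: "('a, 'm) partial_magma_scheme" (structure)
  assumes mult_closed:
      "\<lbrakk>g \<in> carrier G; h \<in> carrier G; g \<cdot> h = Some k\<rbrakk> \<Longrightarrow> k \<in> carrier G"
    and mult_assoc:
      "\<lbrakk>g \<in> carrier G; h \<in> carrier G; l \<in> carrier G\<rbrakk> \<Longrightarrow>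
        Option.bind (h \<cdot> l) (\<lambda>x. g \<cdot> x) = Option.bind (g \<cdot> h) (\<lambda>y. y \<cdot> l)"
    and mult_defined_iff:
      "\<lbrakk>g \<in> carrier G; h \<in> carrier G; l \<in> carrier G\<rbrakk> \<Longrightarrow>
        Option.bind (h \<cdot> l) (\<lambda>x. g \<cdot> x) \<noteq> None \<longleftrightarrow> g \<cdot> h \<noteq> None \<and> h \<cdot> l \<noteq> None"
    and ex1_gdom: "g \<in> carrier G \<Longrightarrow> \<exists>!e. e \<in> carrier G \<and> g \<cdot> e = Some g"
    and ex1_gran: "g \<in> carrier G \<Longrightarrow> \<exists>!e. e \<in> carrier G \<and> e \<cdot> g = Some g"
    and ex_ginv: "g \<in> carrier G \<Longrightarrow>
        \<exists>x \<in> carrier G. x \<cdot> g = Some (gdom G g) \<and> g \<cdot> x = Some (gran G g)"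

definition ginv :: "('a, 'm) partial_magma_scheme \<Rightarrow> 'a \<Rightarrow> 'a" where
  "ginv G g = (THE x. x \<in> carrier G \<and>
     x \<cdot>\<^bsub>G\<^esub> g = Some (gdom G g) \<and> g \<cdot>\<^bsub>G\<^esub> x = Some (gran G g))"

definition isotropy :: "('a, 'm) partial_magma_scheme \<Rightarrow> 'a \<Rightarrow> 'a set" where
  "isotropy G e = {g \<in> carrier G. gdom G g = e \<and> gran G g = e}"

text \<open>
  The elements \<open>g\<^sup>-\<^sup>1hg\<close> for \<open>h \<in> K\<close>, keeping only those that are defined; below, \<open>K\<close> always
  consists of elements with domain and range \<open>gran G g\<close>, for which the product exists.
\<close>

definition conjugate_set :: "('a, 'm) partial_magma_scheme \<Rightarrow> 'a \<Rightarrow> 'a set \<Rightarrow> 'a set" where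
  "conjugate_set G g K =
     {k. \<exists>h \<in> K. Option.bind (h \<cdot>\<^bsub>G\<^esub> g) (\<lambda>x. ginv G g \<cdot>\<^bsub>G\<^esub> x) = Some k}"

locale subgroupoid = groupoid G
  for H :: "'a set" and G :: "('a, 'm) partial_magma_scheme" (structure) +
  assumes nonempty: "H \<noteq> {}"
    and subset: "H \<subseteq> carrier G"
    and ginv_closed: "g \<in> H \<Longrightarrow> ginv G g \<in> H"
    and sub_mult_closed: "\<lbrakk>g \<in> H; h \<in> H; g \<cdot> h = Some k\<rbrakk> \<Longrightarrow> k \<in> H"

locale wide_subgroupoid = subgroupoid +
  assumes wide: "identities (G\<lparr>carrier := H\<rparr>) = identities G"

locale normal_subgroupoid = wide_subgroupoid +
  assumes conjugate_subset: "g \<in> carrier G \<Longrightarrow>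
    conjugate_set G g {h \<in> H. gran G h = gran G g \<and> gdom G h = gran G g} \<subseteq> H"

definition normalizer :: "('a, 'm) partial_magma_scheme \<Rightarrow> 'a set \<Rightarrow> 'a set" where
  "normalizer G H = {g \<in> carrier G.
     conjugate_set G g (H \<inter> isotropy G (gran G g)) = H \<inter> isotropy G (gdom G g)}"

end

theory Submission
  imports Defs
begin

text \<open>
  Conjugation by \<open>g\<close> maps \<open>H\<^sub>r\<^sub>(\<^sub>g\<^sub>)\<close> into the isotropy group at \<open>d(g)\<close>, with conjugation by
  \<open>g\<^sup>-\<^sup>1\<close> as its inverse. So if both \<open>g\<close> and \<open>g\<^sup>-\<^sup>1\<close> conjugate isotropy elements of \<open>H\<close> into \<open>H\<close>,
  then \<open>g\<close> normalizes \<open>H\<close>. As a groupoid is closed under inverses, \<open>H\<close> is therefore normal in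
  \<open>K\<close> if and only if \<open>K\<close> is contained in the normalizer, and all four claims follow.
\<close>

section \<open>The total product of a groupoid\<close>

text \<open>A total version lets products be rewritten as plain terms. Outside the domain the value
  is \<open>the None\<close>, so the laws below assume matching domain and range.\<close>

definition gmul :: "('a, 'm) partial_magma_scheme \<Rightarrow> 'a \<Rightarrow> 'a \<Rightarrow> 'a" (infixl \<open>\<odot>\<index>\<close> 70) where
  "g \<odot>\<^bsub>G\<^esub> h = the (g \<cdot>\<^bsub>G\<^esub> h)"

definition conjugate :: "('a, 'm) partial_magma_scheme \<Rightarrow> 'a \<Rightarrow> 'a \<Rightarrow> 'a" where
  "conjugate G g h = ginv G g \<odot>\<^bsub>G\<^esub> (h \<odot>\<^bsub>G\<^esub> g)"

context groupoid
begin

section \<open>Domains and ranges: uniqueness and idempotence\<close>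

lemma gdom_closed [simp]: "g \<in> carrier G \<Longrightarrow> gdom G g \<in> carrier G"
  and mult_gdom: "g \<in> carrier G \<Longrightarrow> g \<cdot> gdom G g = Some g"
  using theI'[OF ex1_gdom] unfolding gdom_def by blast+

lemma gran_closed [simp]: "g \<in> carrier G \<Longrightarrow> gran G g \<in> carrier G"
  and mult_gran: "g \<in> carrier G \<Longrightarrow> gran G g \<cdot> g = Some g"
  using theI'[OF ex1_gran] unfolding gran_def by blast+

lemma gdom_eqI: "\<lbrakk>g \<in> carrier G; e \<in> carrier G; g \<cdot> e = Some g\<rbrakk> \<Longrightarrow> gdom G g = e"
  using ex1_gdom gdom_closed mult_gdom by blast

lemma gran_eqI: "\<lbrakk>g \<in> carrier G; e \<in> carrier G; e \<cdot> g = Some g\<rbrakk> \<Longrightarrow> gran G g = e"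
  using ex1_gran gran_closed mult_gran by blast

text \<open>Both \<open>Option.bind\<close> axioms recast as facts about single products: the
  existence of gh and hl forces that of g(hl), and associativity then identifies it with
  (gh)l.\<close>

lemma assoc_left:
  assumes "g \<in> carrier G" "h \<in> carrier G" "l \<in> carrier G" "g \<cdot> h = Some x" "h \<cdot> l = Some y"
  shows "x \<cdot> l = g \<cdot> y" "g \<cdot> y \<noteq> None"
  using mult_assoc[OF assms(1-3)] mult_defined_iff[OF assms(1-3)] assms(4,5) by auto

text \<open>Write d for d(g). As (gd)d = g is defined, so is dd, and g(dd) = g. Uniqueness of the
  right unit of g gives dd = d.\<close>

lemma gdom_idem: "g \<in> carrier G \<Longrightarrow> gdom G g \<cdot> gdom G g = Some (gdom G g)"
proof -
  assume g: "g \<in> carrier G"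
  have d: "gdom G g \<in> carrier G" and gd: "g \<cdot> gdom G g = Some g"
    using g mult_gdom by auto
  have "Option.bind (gdom G g \<cdot> gdom G g) (\<lambda>x. g \<cdot> x) = Some g"
    using mult_assoc[OF g d d] gd by simp
  then obtain z where z: "gdom G g \<cdot> gdom G g = Some z" "g \<cdot> z = Some g"
    by (auto simp: bind_eq_Some_conv)
  then show ?thesis using gdom_eqI[OF g mult_closed[OF d d z(1)] z(2)] by simp
qed

lemma gran_idem: "g \<in> carrier G \<Longrightarrow> gran G g \<cdot> gran G g = Some (gran G g)"
proof -
  assume g: "g \<in> carrier G"
  have r: "gran G g \<in> carrier G" and rg: "gran G g \<cdot> g = Some g"
    using g mult_gran by auto
  have "Option.bind (gran G g \<cdot> gran G g) (\<lambda>x. x \<cdot> g) = Some g"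
    using mult_assoc[OF r r g] rg by simp
  then obtain z where z: "gran G g \<cdot> gran G g = Some z" "z \<cdot> g = Some g"
    by (auto simp: bind_eq_Some_conv)
  then show ?thesis using gran_eqI[OF g mult_closed[OF r r z(1)] z(2)] by simp
qed

text \<open>
  With \<open>u = ef\<close> and an inverse \<open>x\<close> of \<open>u\<close>, \<open>e(fx) = ux = e\<close> forces \<open>fx = e\<close> by uniqueness of
  \<open>d(e)\<close>. As \<open>fx = (xu)x = x(ux) = xe\<close>, this gives \<open>u = ef = (xe)f = xu = f\<close>, and \<open>e = f\<close> by
  uniqueness of \<open>r(f)\<close>.
\<close>

lemma idem_mult_defined_eq:
  assumes e: "e \<in> carrier G" "e \<cdot> e = Some e" and f: "f \<in> carrier G" "f \<cdot> f = Some f"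
    and def: "e \<cdot> f = Some u"
  shows "e = f"
proof -
  have u: "u \<in> carrier G" using mult_closed e f def by blast
  have "e \<cdot> u = Some u" using assoc_left[OF e(1) e(1) f(1) e(2) def] def by simp
  then have ru: "gran G u = e" using gran_eqI e u by blast
  have "u \<cdot> f = Some u" using assoc_left[OF e(1) f(1) f(1) def f(2)] def by simp
  then have du: "gdom G u = f" using gdom_eqI f u by blast
  obtain x where x: "x \<in> carrier G" and xu: "x \<cdot> u = Some f" and ux: "u \<cdot> x = Some e"
    using ex_ginv[OF u] ru du by auto
  have xe: "f \<cdot> x = x \<cdot> e" and "x \<cdot> e \<noteq> None"
    using assoc_left[OF x u x xu ux] by auto
  then obtain w where w: "f \<cdot> x = Some w" "x \<cdot> e = Some w" by auto
  have wc: "w \<in> carrier G" using mult_closed[OF f(1) x w(1)] .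
  have "e \<cdot> w = Some e"
    using assoc_left(1)[OF e(1) f(1) x def w(1)] ux by simp
  then have "w = e"
    using gdom_eqI[OF e(1) wc] gdom_eqI[OF e(1) e(1) e(2)] by simp
  then have "e \<cdot> f = x \<cdot> u"
    using assoc_left(1)[OF x e(1) f(1) w(2) def] by simp
  then have "e \<cdot> f = Some f" using xu by simp
  then show ?thesis
    using gran_eqI[OF f(1) e(1)] gran_eqI[OF f(1) f(1) f(2)] by simp
qed

text \<open>If gh exists, then so does (g d(g))h, hence d(g)h = d(g)(r(h)h), hence d(g)r(h). These
  two idempotents have a defined product, so they agree. This turns the algebraic axioms into the
  categorical composability condition.\<close>

lemma mult_defined_iff_gdom_eq_gran:
  assumes g: "g \<in> carrier G" and h: "h \<in> carrier G"
  shows "g \<cdot> h \<noteq> None \<longleftrightarrow> gdom G g = gran G h"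
proof
  assume "g \<cdot> h \<noteq> None"
  then have "Option.bind (gdom G g \<cdot> h) (\<lambda>x. g \<cdot> x) \<noteq> None"
    using mult_assoc[OF g gdom_closed[OF g] h] mult_gdom[OF g] by simp
  then have "gdom G g \<cdot> h \<noteq> None" by (metis bind.bind_lzero)
  then have "Option.bind (gdom G g \<cdot> gran G h) (\<lambda>x. x \<cdot> h) \<noteq> None"
    using mult_assoc[OF gdom_closed[OF g] gran_closed[OF h] h] mult_gran[OF h] by simp
  then obtain u where "gdom G g \<cdot> gran G h = Some u"
    by (metis bind.bind_lzero option.exhaust)
  then show "gdom G g = gran G h"
    using idem_mult_defined_eq g h gdom_idem gran_idem by simp
next
  assume "gdom G g = gran G h"
  then show "g \<cdot> h \<noteq> None"
    using assoc_left(2)[OF g gdom_closed[OF g] h mult_gdom[OF g]] mult_gran[OF h] by simp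
qed

lemma mult_eq:
  "\<lbrakk>g \<in> carrier G; h \<in> carrier G\<rbrakk> \<Longrightarrow>
    g \<cdot> h = (if gdom G g = gran G h then Some (g \<odot> h) else None)"
  using mult_defined_iff_gdom_eq_gran[of g h] unfolding gmul_def by auto

lemma gmul_closed [simp]:
  "\<lbrakk>g \<in> carrier G; h \<in> carrier G; gdom G g = gran G h\<rbrakk> \<Longrightarrow> g \<odot> h \<in> carrier G"
  using mult_closed[of g h "g \<odot> h"] mult_eq[of g h] by simp

lemma gmul_gdom [simp]: "g \<in> carrier G \<Longrightarrow> g \<odot> gdom G g = g"
  by (simp add: gmul_def mult_gdom)

lemma gran_gmul_self [simp]: "g \<in> carrier G \<Longrightarrow> gran G g \<odot> g = g"
  by (simp add: gmul_def mult_gran)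

lemma gdom_gdom [simp]: "g \<in> carrier G \<Longrightarrow> gdom G (gdom G g) = gdom G g"
  and gran_gdom [simp]: "g \<in> carrier G \<Longrightarrow> gran G (gdom G g) = gdom G g"
  and gdom_gran [simp]: "g \<in> carrier G \<Longrightarrow> gdom G (gran G g) = gran G g"
  and gran_gran [simp]: "g \<in> carrier G \<Longrightarrow> gran G (gran G g) = gran G g"
  by (simp_all add: gdom_eqI gran_eqI gdom_idem gran_idem)

text \<open>Since (gh)d(h) = g(h d(h)) = gh, the element d(h) is a right unit of gh, and right units
  are unique; dually for r(g).\<close>

lemma
  assumes g: "g \<in> carrier G" and h: "h \<in> carrier G" and gh: "gdom G g = gran G h"
  shows gdom_gmul [simp]: "gdom G (g \<odot> h) = gdom G h"
    and gran_gmul [simp]: "gran G (g \<odot> h) = gran G g"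
proof -
  have eq: "g \<cdot> h = Some (g \<odot> h)" using mult_eq[OF g h] gh by simp
  show "gdom G (g \<odot> h) = gdom G h"
    using assoc_left(1)[OF g h _ eq mult_gdom[OF h]] eq g h gh by (simp add: gdom_eqI)
  show "gran G (g \<odot> h) = gran G g"
    using assoc_left(1)[OF _ g h mult_gran[OF g] eq] eq g h gh by (simp add: gran_eqI)
qed

lemma gmul_assoc:
  assumes g: "g \<in> carrier G" and h: "h \<in> carrier G" and l: "l \<in> carrier G"
    and gh: "gdom G g = gran G h" and hl: "gdom G h = gran G l"
  shows "g \<odot> h \<odot> l = g \<odot> (h \<odot> l)"
  using assoc_left(1)[OF g h l, of "g \<odot> h" "h \<odot> l"] assms by (simp add: mult_eq)

section \<open>Inverses and identities\<close>

lemma inverse_unique: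
  assumes g: "g \<in> carrier G"
  shows "\<exists>!x. x \<in> carrier G \<and> x \<cdot> g = Some (gdom G g) \<and> g \<cdot> x = Some (gran G g)"
proof (rule ex_ex1I)
  show "\<exists>x. x \<in> carrier G \<and> x \<cdot> g = Some (gdom G g) \<and> g \<cdot> x = Some (gran G g)"
    using ex_ginv[OF g] by blast
next
  fix x y
  assume "x \<in> carrier G \<and> x \<cdot> g = Some (gdom G g) \<and> g \<cdot> x = Some (gran G g)"
    and "y \<in> carrier G \<and> y \<cdot> g = Some (gdom G g) \<and> g \<cdot> y = Some (gran G g)"
  then have x: "x \<in> carrier G" "gdom G x = gran G g" "gran G x = gdom G g" "x \<odot> g = gdom G g"
    and y: "y \<in> carrier G" "gdom G y = gran G g" "gran G y = gdom G g" "g \<odot> y = gran G g"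
    using g by (auto simp: mult_eq split: if_splits)
  have "x = x \<odot> (g \<odot> y)" using x y gmul_gdom[of x] by simp
  also have "\<dots> = x \<odot> g \<odot> y" using x(1-3) y(1-3) g by (simp add: gmul_assoc)
  also have "\<dots> = y" using x y gran_gmul_self[of y] by simp
  finally show "x = y" .
qed

lemma
  assumes g: "g \<in> carrier G"
  shows ginv_closed_carrier [simp]: "ginv G g \<in> carrier G"
    and ginv_mult: "ginv G g \<cdot> g = Some (gdom G g)"
    and mult_ginv: "g \<cdot> ginv G g = Some (gran G g)"
  using theI'[OF inverse_unique[OF g]] unfolding ginv_def by auto

lemma
  assumes g: "g \<in> carrier G"
  shows gdom_ginv [simp]: "gdom G (ginv G g) = gran G g"
    and gran_ginv [simp]: "gran G (ginv G g) = gdom G g"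
    and ginv_gmul [simp]: "ginv G g \<odot> g = gdom G g"
    and gmul_ginv [simp]: "g \<odot> ginv G g = gran G g"
  using ginv_mult[OF g] mult_ginv[OF g] g by (auto simp: mult_eq split: if_splits)

lemma ginv_eqI:
  assumes "g \<in> carrier G" "x \<in> carrier G" "x \<cdot> g = Some (gdom G g)" "g \<cdot> x = Some (gran G g)"
  shows "ginv G g = x"
  unfolding ginv_def using assms by (intro the1_equality inverse_unique) auto

lemma ginv_ginv [simp]: "g \<in> carrier G \<Longrightarrow> ginv G (ginv G g) = g"
  by (rule ginv_eqI) (simp_all add: ginv_mult mult_ginv)

text \<open>Rebracketing to the right by \<open>gmul_assoc\<close> hides the adjacent inverse pair
  from \<open>gmul_ginv\<close> and \<open>ginv_gmul\<close>; these rules recover the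
  cancellation.\<close>

lemma gmul_cancel:
  assumes "g \<in> carrier G" "h \<in> carrier G"
  shows "gran G h = gran G g \<Longrightarrow> g \<odot> (ginv G g \<odot> h) = h"
    and "gran G h = gdom G g \<Longrightarrow> ginv G g \<odot> (g \<odot> h) = h"
  using assms gran_gmul_self[of h] by (simp_all flip: gmul_assoc)

lemma ginv_gmul_distrib:
  assumes g: "g \<in> carrier G" and h: "h \<in> carrier G" and gh: "gdom G g = gran G h"
  shows "ginv G (g \<odot> h) = ginv G h \<odot> ginv G g"
  by (rule ginv_eqI)
    (use assms gmul_cancel(1)[of h "ginv G g"] gmul_cancel(2)[of g h]
      in \<open>simp_all add: mult_eq gmul_assoc\<close>)

text \<open>For an identity e, the product e d(e) is e by definition of d and d(e) because e is an
  identity. Conversely, if d(e) = e then r(e) = e as well, and a defined eg has r(g) = e, so eg = g;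
  likewise on the other side.\<close>

lemma identities_eq: "identities G = {e \<in> carrier G. gdom G e = e}"
proof (intro Set.equalityI subsetI)
  fix e assume "e \<in> identities G"
  then have e: "e \<in> carrier G"
    and id: "\<And>g. \<lbrakk>g \<in> carrier G; e \<cdot> g \<noteq> None\<rbrakk> \<Longrightarrow> e \<cdot> g = Some g"
    unfolding identities_def by auto
  have "Some e = Some (gdom G e)" using id[of "gdom G e"] e by (simp add: mult_gdom)
  then show "e \<in> {e \<in> carrier G. gdom G e = e}" using e by simp
next
  fix e assume "e \<in> {e \<in> carrier G. gdom G e = e}"
  then have e: "e \<in> carrier G" "gdom G e = e" "gran G e = e"
    using gran_gdom[of e] by auto
  then show "e \<in> identities G"
    using mult_gran mult_gdom mult_defined_iff_gdom_eq_gran[of e]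
      mult_defined_iff_gdom_eq_gran[of _ e] unfolding identities_def by force
qed

section \<open>Conjugation\<close>

text \<open>On isotropy elements every product involved exists, so the definedness filter discards
  nothing and the set is an honest image.\<close>

lemma conjugate_set_eq:
  assumes g: "g \<in> carrier G" and K: "K \<subseteq> isotropy G (gran G g)"
  shows "conjugate_set G g K = conjugate G g ` K"
proof -
  have "Option.bind (h \<cdot> g) (\<lambda>x. ginv G g \<cdot> x) = Some (conjugate G g h)" if "h \<in> K" for h
    using that g K by (auto simp: isotropy_def mult_eq conjugate_def)
  then show ?thesis unfolding conjugate_set_def by auto
qed

lemma conjugate_isotropy:
  assumes "g \<in> carrier G" "h \<in> isotropy G (gran G g)"
  shows "conjugate G g h \<in> isotropy G (gdom G g)"
  using assms by (simp add: isotropy_def conjugate_def)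

text \<open>Inversion reverses products, so conjugation acts from the right: first by
  \<open>g\<close>, then by \<open>k\<close>.\<close>

lemma conjugate_gmul:
  assumes "g \<in> carrier G" "k \<in> carrier G" "gdom G g = gran G k" "h \<in> isotropy G (gran G g)"
  shows "conjugate G (g \<odot> k) h = conjugate G k (conjugate G g h)"
  using assms by (simp add: isotropy_def conjugate_def ginv_gmul_distrib gmul_assoc)

lemma conjugate_ginv_conjugate:
  assumes "g \<in> carrier G" "h \<in> isotropy G (gran G g)"
  shows "conjugate G (ginv G g) (conjugate G g h) = h"
proof -
  have g: "g \<in> carrier G" and h: "h \<in> carrier G" "gdom G h = gran G g" "gran G h = gran G g"
    using assms by (auto simp: isotropy_def)
  have "conjugate G (ginv G g) (conjugate G g h) = g \<odot> (ginv G g \<odot> (h \<odot> g \<odot> ginv G g))"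
    using g h by (simp add: conjugate_def gmul_assoc)
  \<comment> \<open>The outer pair cancels here; the remaining g g^-1 is r(g) = d(h), a right unit
    of h.\<close>
  also have "\<dots> = h \<odot> g \<odot> ginv G g"
    using g h by (intro gmul_cancel) auto
  also have "\<dots> = h \<odot> gdom G h"
    using g h by (simp add: gmul_assoc)
  finally show ?thesis using h(1) by simp
qed

section \<open>The normalizer: membership criterion and closure\<close>

lemma mem_normalizer_iff:
  "g \<in> normalizer G H \<longleftrightarrow> g \<in> carrier G \<and>
    conjugate G g ` (H \<inter> isotropy G (gran G g)) = H \<inter> isotropy G (gdom G g)"
  by (simp add: normalizer_def conjugate_set_eq cong: conj_cong)

lemma mem_normalizerI:
  assumes g: "g \<in> carrier G"
    and conjugate: "\<And>h. h \<in> H \<inter> isotropy G (gran G g) \<Longrightarrow> conjugate G g h \<in> H"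
    and conjugate_inv: "\<And>h. h \<in> H \<inter> isotropy G (gdom G g) \<Longrightarrow> conjugate G (ginv G g) h \<in> H"
  shows "g \<in> normalizer G H"
proof -
  have "h \<in> conjugate G g ` (H \<inter> isotropy G (gran G g))" if h: "h \<in> H \<inter> isotropy G (gdom G g)" for h
  proof (rule image_eqI)
    \<comment> \<open>The preimage of \<open>h\<close> is its conjugate by g^-1; the inverse law is
      read at g^-1, whose inverse is g.\<close>
    show "h = conjugate G g (conjugate G (ginv G g) h)"
      using conjugate_ginv_conjugate[of "ginv G g" h] g h by simp
    show "conjugate G (ginv G g) h \<in> H \<inter> isotropy G (gran G g)"
      using conjugate_inv[OF h] conjugate_isotropy[of "ginv G g" h] g h by simp
  qed
  then show ?thesis
    using g conjugate conjugate_isotropy[OF g] by (auto simp: mem_normalizer_iff)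
qed

text \<open>By the normalizer equation each element of \<open>H\<close> at d(g) is the g-conjugate
  of one at r(g), and conjugation by g^-1 returns that element of \<open>H\<close>.\<close>

lemma ginv_mem_normalizer:
  assumes "g \<in> normalizer G H"
  shows "ginv G g \<in> normalizer G H"
proof -
  have g: "g \<in> carrier G"
    and img: "conjugate G g ` (H \<inter> isotropy G (gran G g)) = H \<inter> isotropy G (gdom G g)"
    using assms by (auto simp: mem_normalizer_iff)
  have "conjugate G (ginv G g) h \<in> H" if "h \<in> H \<inter> isotropy G (gdom G g)" for h
    using that conjugate_ginv_conjugate[OF g] unfolding img[symmetric] by auto
  then show ?thesis
    by (intro mem_normalizerI) (use g img in auto)
qed

text \<open>The images compose: \<open>H\<close> at r(g) is carried onto \<open>H\<close> at d(g) =
  r(k), and then onto \<open>H\<close> at d(k).\<close>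

lemma gmul_mem_normalizer:
  assumes g: "g \<in> normalizer G H" and k: "k \<in> normalizer G H" and gk: "gdom G g = gran G k"
  shows "g \<odot> k \<in> normalizer G H"
proof -
  have carr: "g \<in> carrier G" "k \<in> carrier G"
    using g k by (auto simp: mem_normalizer_iff)
  have "conjugate G (g \<odot> k) ` (H \<inter> isotropy G (gran G g))
      = conjugate G k ` conjugate G g ` (H \<inter> isotropy G (gran G g))"
    unfolding image_image using conjugate_gmul[OF carr gk] by (intro image_cong) auto
  then show ?thesis
    using g k gk carr by (simp add: mem_normalizer_iff)
qed

end

section \<open>Subgroupoids\<close>

context subgroupoid
begin

lemma mem_carrier [simp]: "g \<in> H \<Longrightarrow> g \<in> carrier G"
  using subset by blast

lemma gmul_mem: "\<lbrakk>g \<in> H; h \<in> H; gdom G g = gran G h\<rbrakk> \<Longrightarrow> g \<odot> h \<in> H"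
  using sub_mult_closed[of g h] by (simp add: mult_eq)

lemma gdom_mem: "g \<in> H \<Longrightarrow> gdom G g \<in> H"
  using gmul_mem[of "ginv G g" g] ginv_closed by simp

lemma gran_mem: "g \<in> H \<Longrightarrow> gran G g \<in> H"
  using gmul_mem[of g "ginv G g"] ginv_closed by simp

text \<open>The description defining \<open>gdom\<close> ranges over the carrier, so shrinking it
  might change the value. It does not, because d(g) stays in \<open>H\<close> and is already unique
  in \<open>G\<close>.\<close>

lemma gdom_restrict: "g \<in> H \<Longrightarrow> gdom (G\<lparr>carrier := H\<rparr>) g = gdom G g"
  unfolding gdom_def[of "G\<lparr>carrier := H\<rparr>"]
  by (rule the_equality) (auto simp: gdom_mem mult_gdom intro: gdom_eqI[symmetric])

lemma gran_restrict: "g \<in> H \<Longrightarrow> gran (G\<lparr>carrier := H\<rparr>) g = gran G g"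
  unfolding gran_def[of "G\<lparr>carrier := H\<rparr>"]
  by (rule the_equality) (auto simp: gran_mem mult_gran intro: gran_eqI[symmetric])

lemma ginv_restrict: "g \<in> H \<Longrightarrow> ginv (G\<lparr>carrier := H\<rparr>) g = ginv G g"
  unfolding ginv_def[of "G\<lparr>carrier := H\<rparr>"]
  by (rule the_equality)
    (auto simp: ginv_closed ginv_mult mult_ginv gdom_restrict gran_restrict
      intro: ginv_eqI[symmetric])

lemma groupoid_restrict: "groupoid (G\<lparr>carrier := H\<rparr>)"
proof
  fix g assume "g \<in> carrier (G\<lparr>carrier := H\<rparr>)"
  then have g: "g \<in> H" by simp
  show "\<exists>!e. e \<in> carrier (G\<lparr>carrier := H\<rparr>) \<and> g \<cdot>\<^bsub>G\<lparr>carrier := H\<rparr>\<^esub> e = Some g"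
    by (rule ex1I[of _ "gdom G g"]) (use g in \<open>auto simp: gdom_mem mult_gdom intro: gdom_eqI[symmetric]\<close>)
  show "\<exists>!e. e \<in> carrier (G\<lparr>carrier := H\<rparr>) \<and> e \<cdot>\<^bsub>G\<lparr>carrier := H\<rparr>\<^esub> g = Some g"
    by (rule ex1I[of _ "gran G g"]) (use g in \<open>auto simp: gran_mem mult_gran intro: gran_eqI[symmetric]\<close>)
  show "\<exists>x \<in> carrier (G\<lparr>carrier := H\<rparr>).
      x \<cdot>\<^bsub>G\<lparr>carrier := H\<rparr>\<^esub> g = Some (gdom (G\<lparr>carrier := H\<rparr>) g) \<and>
      g \<cdot>\<^bsub>G\<lparr>carrier := H\<rparr>\<^esub> x = Some (gran (G\<lparr>carrier := H\<rparr>) g)"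
    by (rule bexI[of _ "ginv G g"])
      (use g in \<open>simp_all add: ginv_closed ginv_mult mult_ginv gdom_restrict gran_restrict\<close>)
next
  fix g h l
  show "l \<in> carrier (G\<lparr>carrier := H\<rparr>)"
    if "g \<in> carrier (G\<lparr>carrier := H\<rparr>)" "h \<in> carrier (G\<lparr>carrier := H\<rparr>)"
      "g \<cdot>\<^bsub>G\<lparr>carrier := H\<rparr>\<^esub> h = Some l"
    using that sub_mult_closed[of g h l] by simp
  assume "g \<in> carrier (G\<lparr>carrier := H\<rparr>)" "h \<in> carrier (G\<lparr>carrier := H\<rparr>)"
    "l \<in> carrier (G\<lparr>carrier := H\<rparr>)"
  then have ghl: "g \<in> carrier G" "h \<in> carrier G" "l \<in> carrier G" using subset by auto
  show "Option.bind (h \<cdot>\<^bsub>G\<lparr>carrier := H\<rparr>\<^esub> l) (\<lambda>x. g \<cdot>\<^bsub>G\<lparr>carrier := H\<rparr>\<^esub> x)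
      = Option.bind (g \<cdot>\<^bsub>G\<lparr>carrier := H\<rparr>\<^esub> h) (\<lambda>y. y \<cdot>\<^bsub>G\<lparr>carrier := H\<rparr>\<^esub> l)"
    using mult_assoc[OF ghl] by simp
  show "Option.bind (h \<cdot>\<^bsub>G\<lparr>carrier := H\<rparr>\<^esub> l) (\<lambda>x. g \<cdot>\<^bsub>G\<lparr>carrier := H\<rparr>\<^esub> x) \<noteq> None \<longleftrightarrow>
      g \<cdot>\<^bsub>G\<lparr>carrier := H\<rparr>\<^esub> h \<noteq> None \<and> h \<cdot>\<^bsub>G\<lparr>carrier := H\<rparr>\<^esub> l \<noteq> None"
    using mult_defined_iff[OF ghl] by simp
qed

text \<open>An identity of \<open>H\<close> is tested only against elements of \<open>H\<close>. The
  criterion d(e) = e removes this dependence, as d is the same in both groupoids.\<close>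

lemma identities_restrict: "identities (G\<lparr>carrier := H\<rparr>) = H \<inter> identities G"
  using groupoid.identities_eq[OF groupoid_restrict] subset gdom_restrict
  by (auto simp: identities_eq)

lemma wide_subgroupoid_iff: "wide_subgroupoid H G \<longleftrightarrow> identities G \<subseteq> H"
  using subgroupoid_axioms identities_restrict
  by (auto simp: wide_subgroupoid_def wide_subgroupoid_axioms_def)

lemma conjugate_mem:
  assumes g: "g \<in> H" and h: "h \<in> H \<inter> isotropy G (gran G g)"
  shows "conjugate G g h \<in> H"
proof -
  have "h \<odot> g \<in> H" using g h by (auto intro: gmul_mem simp: isotropy_def)
  then show ?thesis
    using g h subset ginv_closed unfolding conjugate_def
    by (intro gmul_mem) (auto simp: isotropy_def)
qed

lemma subset_normalizer: "H \<subseteq> normalizer G H"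
proof
  fix g assume g: "g \<in> H"
  then show "g \<in> normalizer G H"
    using subset conjugate_mem[OF g] conjugate_mem[OF ginv_closed[OF g]]
    by (intro mem_normalizerI) auto
qed

lemma subgroupoid_normalizer: "subgroupoid (normalizer G H) G"
proof
  show "normalizer G H \<noteq> {}" using subset_normalizer nonempty by auto
  show sub: "normalizer G H \<subseteq> carrier G" by (auto simp: normalizer_def)
  show "k \<in> normalizer G H"
    if "g \<in> normalizer G H" "h \<in> normalizer G H" "g \<cdot> h = Some k" for g h k
    using that sub gmul_mem_normalizer[of g H h] by (auto simp: mult_eq subset_iff split: if_splits)
qed (rule ginv_mem_normalizer)

text \<open>Allows normality inside a subgroupoid to be compared with the normalizer taken in
  \<open>G\<close>.\<close>

lemma normalizer_restrict:
  assumes K: "K \<subseteq> H"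
  shows "normalizer (G\<lparr>carrier := H\<rparr>) K = H \<inter> normalizer G K"
proof -
  have "conjugate_set (G\<lparr>carrier := H\<rparr>) g L = conjugate_set G g L" if "g \<in> H" for g L
    using that by (simp add: conjugate_set_def ginv_restrict)
  \<comment> \<open>Isotropy groups of \<open>H\<close> may be smaller than those of
    \<open>G\<close>, but inside \<open>K\<close>, a subset of \<open>H\<close>, they agree.\<close>
  moreover have "K \<inter> isotropy (G\<lparr>carrier := H\<rparr>) e = K \<inter> isotropy G e" for e
    using K subset by (auto simp: isotropy_def gdom_restrict gran_restrict)
  ultimately show ?thesis
    using subset by (auto simp: normalizer_def gdom_restrict gran_restrict)
qed

lemma subgroupoid_restrict:
  assumes "subgroupoid K G" "K \<subseteq> H"
  shows "subgroupoid K (G\<lparr>carrier := H\<rparr>)"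
proof -
  interpret K: subgroupoid K G by fact
  interpret R: groupoid "G\<lparr>carrier := H\<rparr>" by (rule groupoid_restrict)
  show ?thesis
  proof
    show "ginv (G\<lparr>carrier := H\<rparr>) g \<in> K" if "g \<in> K" for g
      using that assms(2) K.ginv_closed ginv_restrict by auto
    show "k \<in> K" if "g \<in> K" "h \<in> K" "g \<cdot>\<^bsub>G\<lparr>carrier := H\<rparr>\<^esub> h = Some k" for g h k
      using that K.sub_mult_closed[of g h k] by simp
  qed (use assms(2) K.nonempty in simp_all)
qed

end

section \<open>Normality in terms of the normalizer\<close>

context wide_subgroupoid
begin

lemma normal_subgroupoid_iff: "normal_subgroupoid H G \<longleftrightarrow> normalizer G H = carrier G"
proof -
  have iso: "{h \<in> H. gran G h = gran G g \<and> gdom G h = gran G g} = H \<inter> isotropy G (gran G g)" for g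
    using subset by (auto simp: isotropy_def)
  have "normal_subgroupoid H G \<longleftrightarrow>
      (\<forall>g \<in> carrier G. conjugate G g ` (H \<inter> isotropy G (gran G g)) \<subseteq> H)"
    using wide_subgroupoid_axioms
    by (auto simp: normal_subgroupoid_def normal_subgroupoid_axioms_def iso conjugate_set_eq)
  also have "\<dots> \<longleftrightarrow> carrier G \<subseteq> normalizer G H"
  proof
    assume conjugate: "\<forall>g \<in> carrier G. conjugate G g ` (H \<inter> isotropy G (gran G g)) \<subseteq> H"
    show "carrier G \<subseteq> normalizer G H"
    proof
      fix g assume g: "g \<in> carrier G"
      \<comment> \<open>Normality gives only inclusions; used at g and at g^-1 it provides both
        hypotheses of \<open>mem_normalizerI\<close>.\<close>
      have "conjugate G g ` (H \<inter> isotropy G (gran G g)) \<subseteq> H"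
        "conjugate G (ginv G g) ` (H \<inter> isotropy G (gdom G g)) \<subseteq> H"
        using conjugate[rule_format, OF g] conjugate[rule_format, of "ginv G g"] g by auto
      then show "g \<in> normalizer G H" by (intro mem_normalizerI g) auto
    qed
  next
    assume "carrier G \<subseteq> normalizer G H"
    then show "\<forall>g \<in> carrier G. conjugate G g ` (H \<inter> isotropy G (gran G g)) \<subseteq> H"
      unfolding subset_iff[of "carrier G"] mem_normalizer_iff by simp
  qed
  also have "\<dots> \<longleftrightarrow> normalizer G H = carrier G" by (auto simp: normalizer_def)
  finally show ?thesis .
qed

lemma wide_subgroupoid_normalizer: "wide_subgroupoid (normalizer G H) G"
  using subgroupoid.wide_subgroupoid_iff[OF subgroupoid_normalizer]
    wide_subgroupoid_iff wide_subgroupoid_axioms subset_normalizer by blast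

text \<open>The preceding criterion, applied in the groupoid \<open>K\<close>, asks that the
  normalizer of \<open>H\<close> in \<open>K\<close> be all of \<open>K\<close>; by
  \<open>normalizer_restrict\<close> that normalizer is the part of \<open>normalizer G H\<close> in
  \<open>K\<close>.\<close>

lemma normal_subgroupoid_restrict_iff:
  assumes K: "wide_subgroupoid K G"
  shows "normal_subgroupoid H (G\<lparr>carrier := K\<rparr>) \<longleftrightarrow> H \<subseteq> K \<and> K \<subseteq> normalizer G H"
proof (cases "H \<subseteq> K")
  case True
  interpret K: wide_subgroupoid K G by fact
  interpret HK: subgroupoid H "G\<lparr>carrier := K\<rparr>"
    using K.subgroupoid_restrict[OF subgroupoid_axioms True] .
  \<comment> \<open>\<open>K\<close> is wide, so its identities are those of \<open>G\<close>, which
    lie in \<open>H\<close>.\<close>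
  have "identities (G\<lparr>carrier := K\<rparr>) \<subseteq> H"
    using K.wide wide_subgroupoid_iff wide_subgroupoid_axioms by simp
  then interpret HK: wide_subgroupoid H "G\<lparr>carrier := K\<rparr>"
    using HK.wide_subgroupoid_iff by simp
  show ?thesis
    using HK.normal_subgroupoid_iff K.normalizer_restrict[OF True] True by auto
next
  case False
  moreover have "H \<subseteq> K" if "normal_subgroupoid H (G\<lparr>carrier := K\<rparr>)"
  proof -
    interpret normal_subgroupoid H "G\<lparr>carrier := K\<rparr>" by fact
    show ?thesis using subset by simp
  qed
  ultimately show ?thesis by blast
qed

end

theorem proposition3p3:
  fixes G :: "('a, 'm) partial_magma_scheme" and H :: "'a set"
  assumes "groupoid G"
    and "wide_subgroupoid H G"
  shows "(wide_subgroupoid (normalizer G H) G \<and> H \<subseteq> normalizer G H) \<and>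
    normal_subgroupoid H (G\<lparr>carrier := normalizer G H\<rparr>) \<and>
    ((wide_subgroupoid (normalizer G H) G \<and>
        normal_subgroupoid H (G\<lparr>carrier := normalizer G H\<rparr>)) \<and>
      (\<forall>K. wide_subgroupoid K G \<and> normal_subgroupoid H (G\<lparr>carrier := K\<rparr>)
         \<longrightarrow> K \<subseteq> normalizer G H)) \<and>
    (normalizer G H = carrier G \<longleftrightarrow> normal_subgroupoid H G)"
proof -
  interpret wide_subgroupoid H G by fact
  \<comment> \<open>Taking the normalizer itself as \<open>K\<close> in
    \<open>normal_subgroupoid_restrict_iff\<close> gives normality of \<open>H\<close> in it; an
    arbitrary \<open>K\<close> gives maximality.\<close>
  show ?thesis
    using wide_subgroupoid_normalizer subset_normalizer normal_subgroupoid_iff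
      normal_subgroupoid_restrict_iff by auto
qed

end
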